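(* Let $n\in\mathbb{N}$ (with $n\ge 1$). For every non-flat continuum $K\subset\mathbb{R}^n$, the $n$-fold sum $K^{+n}$ has non-empty interior in $\mathbb{R}^n$, and hence $K$ belongs to the class $\mathcal A(\mathbb{R}^n)=\mathcal B(\mathbb{R}^n)$. Moreover, if a continuum $K\subset\mathbb{R}^n$ is locally connected and nowhere flat in $\mathbb{R}^n$, then for every analytic subspace $A$ of $K$ that is non-meager in $K$, the $2n$-fold sum $A^{+2n}$ has non-empty interior in $\mathbb{R}^n$, which implies that $A\in\mathcal A(\mathbb{R}^n)=\mathcal B(\mathbb{R}^n)$.
   Context: A continuum is a connected compact metrizable space. A subset $A$ of a real topological vector space $X$ is flat if its affine hull is nowhere dense in $X$ (for $X=\mathbb{R}^n$: the affine hull is not all of $\mathbb{R}^n$); $A$ is nowhere flat if each non-empty relatively open subset $U\subset A$ is not flat in $X$. For $T\subset X$ and $m\in\mathbb{N}$, $T^{+m}=T+\dots+T$ ($m$ times) $=\{t_1+\dots+t_m: t_1,\dots,t_m\in T\}$. A subspace of $\mathbb{R}^n$ is analytic if it is a continuous image of a Polish space (or empty). "Non-meager in $K$" means not of first category in the topological space $K$. A function $f:X\to\mathbb{R}$ is additive if $f(x+y)=f(x)+f(y)$ for all $x,y\in X$. A function $f:D\to\mathbb{R}$ on a convex set $D\subset X$ is mid-convex if $f\big(\tfrac{x+y}{2}\big)\le\tfrac{f(x)+f(y)}{2}$ for all $x,y\in D$. $\mathcal A(X)$ is the family of all $T\subset X$ such that every mid-convex function $f:D\to\mathbb{R}$ defined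 on a convex open set $D\subset X$ containing $T$ is continuous if $\sup f(T)<\infty$. $\mathcal B(X)$ is the family of all $T\subset X$ such that every additive function $f:X\to\mathbb{R}$ with $\sup f(T)<\infty$ is continuous. It is a known result (Ger and Kominek) that $\mathcal A(\mathbb{R}^n)=\mathcal B(\mathbb{R}^n)$. *)

theory Defs
  imports "HOL-Analysis.Analysis"
begin

text \<open>Connectedness of the empty set is allowed here; this is harmless for what follows, since the
  empty set is flat and all its subsets are meager in it.\<close>

definition continuum :: "'a::metric_space set \<Rightarrow> bool" where
  "continuum K \<longleftrightarrow> compact K \<and> connected K"

definition nowhere_dense_in :: "'a topology \<Rightarrow> 'a set \<Rightarrow> bool" where
  "nowhere_dense_in X S \<longleftrightarrow> S \<subseteq> topspace X \<and> X interior_of (X closure_of S) = {}"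

definition meager_in :: "'a topology \<Rightarrow> 'a set \<Rightarrow> bool" where
  "meager_in X S \<longleftrightarrow> (\<exists>\<N>. countable \<N> \<and> (\<forall>N\<in>\<N>. nowhere_dense_in X N) \<and> S = \<Union>\<N>)"

definition flat :: "'a::real_normed_vector set \<Rightarrow> bool" where
  "flat A \<longleftrightarrow> nowhere_dense_in euclidean (affine hull A)"

definition nowhere_flat :: "'a::real_normed_vector set \<Rightarrow> bool" where
  "nowhere_flat A \<longleftrightarrow> (\<forall>U. openin (top_of_set A) U \<and> U \<noteq> {} \<longrightarrow> \<not> flat U)"

definition nfold_sum :: "nat \<Rightarrow> 'a::comm_monoid_add set \<Rightarrow> 'a set" where
  "nfold_sum m T = {(\<Sum>i<m. t i) | t. \<forall>i<m. t i \<in> T}"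

definition polish :: "'a topology \<Rightarrow> bool" where
  "polish X \<longleftrightarrow> completely_metrizable_space X \<and> second_countable X"

text \<open>A bound variable cannot range over spaces on arbitrary types, so the carrier of the Polish space
  is taken inside one fixed type, on which the topology is arbitrary. Lemma \<open>analyticI\<close> shows
  that this loses no generality. The empty set is covered by the empty Polish space.\<close>

definition analytic :: "'a::topological_space set \<Rightarrow> bool" where
  "analytic A \<longleftrightarrow>
    (\<exists>(X :: (nat \<Rightarrow> real) topology) f. polish X \<and> continuous_map X euclidean f \<and> f ` topspace X = A)"

lemma analyticI:
  fixes X :: "'b topology" and f :: "'b \<Rightarrow> 'a::topological_space"
  assumes "polish X" and f: "continuous_map X euclidean f"
  shows "analytic (f ` topspace X)"
proof -
  have cm: "completely_metrizable_space X" and sc: "second_countable X"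
    using assms by (auto simp: polish_def)
  obtain \<B> where \<B>: "countable \<B>" "\<forall>V\<in>\<B>. openin X V"
    and base: "\<And>U x. openin X U \<Longrightarrow> x \<in> U \<Longrightarrow> \<exists>V\<in>\<B>. x \<in> V \<and> V \<subseteq> U"
    using sc unfolding second_countable_def by metis
  define g :: "'b \<Rightarrow> nat \<Rightarrow> real"
    where "g = (\<lambda>x n. if x \<in> from_nat_into \<B> n then 1 else 0)"
  have haus: "Hausdorff_space X"
    using cm by (simp add: completely_metrizable_imp_metrizable_space metrizable_imp_Hausdorff_space)
  have inj: "inj_on g (topspace X)"
  proof (rule inj_onI, rule ccontr)
    fix x y assume xy: "x \<in> topspace X" "y \<in> topspace X" "g x = g y" "x \<noteq> y"
    then obtain U where U: "openin X U" "x \<in> U" "y \<notin> U"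
      using haus unfolding Hausdorff_space_def by (metis disjnt_iff)
    then obtain V where V: "V \<in> \<B>" "x \<in> V" "V \<subseteq> U"
      using base by blast
    then obtain n where "from_nat_into \<B> n = V"
      using from_nat_into_surj[OF \<B>(1)] by metis
    then have "g x n = 1" "g y n = 0"
      using V U by (auto simp: g_def)
    then show False using xy by simp
  qed
  define h where "h = inv_into (topspace X) g"
  define Y where "Y = pullback_topology (g ` topspace X) h X"
  have hg: "\<And>x. x \<in> topspace X \<Longrightarrow> h (g x) = x"
    using inj by (simp add: h_def)
  have topY: "topspace Y = g ` topspace X"
    using hg by (auto simp: Y_def topspace_pullback_topology)
  have cg: "continuous_map X Y g"
    unfolding Y_def
  proof (rule continuous_map_pullback')
    show "continuous_map X X (h \<circ> g)"
      by (rule continuous_map_eq[OF continuous_map_id]) (simp add: hg)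
  qed auto
  have ch: "continuous_map Y X h"
    using continuous_map_pullback[OF continuous_map_id] by (simp add: Y_def)
  have "homeomorphic_maps X Y g h"
    using cg ch hg topY by (auto simp: homeomorphic_maps_def)
  then have hom: "X homeomorphic_space Y"
    unfolding homeomorphic_space_def by blast
  have "polish Y"
    using cm sc homeomorphic_completely_metrizable_space[OF hom] homeomorphic_space_second_countability[OF hom]
    by (simp add: polish_def)
  moreover have "continuous_map Y euclidean (f \<circ> h)"
    using ch f by (rule continuous_map_compose)
  moreover have "(f \<circ> h) ` topspace Y = f ` topspace X"
    using hg by (auto simp: topY image_iff)
  ultimately show ?thesis
    unfolding analytic_def by blast
qed

definition mid_convex_on :: "'a::real_vector set \<Rightarrow> ('a \<Rightarrow> real) \<Rightarrow> bool" where
  "mid_convex_on D f \<longleftrightarrow> (\<forall>x\<in>D. \<forall>y\<in>D. f ((x + y) /\<^sub>R 2) \<le> (f x + f y) / 2)"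

text \<open>The condition \<open>sup f(T) < \<infinity>\<close> is expressed by \<^const>\<open>bdd_above\<close>, which also holds for
  empty \<open>T\<close>, in accordance with \<open>sup \<emptyset> = -\<infinity>\<close>.\<close>

definition class_A :: "'a::real_normed_vector set set" where
  "class_A = {T. \<forall>D f. open D \<and> convex D \<and> T \<subseteq> D \<and> mid_convex_on D f \<and> bdd_above (f ` T)
                   \<longrightarrow> continuous_on D f}"

definition class_B :: "'a::real_normed_vector set set" where
  "class_B = {T. \<forall>f :: 'a \<Rightarrow> real. Modules.additive f \<and> bdd_above (f ` T) \<longrightarrow> continuous_on UNIV f}"

end

theory Submission
  imports Defs
begin

text \<open>Choose points \<open>a i\<close>, \<open>b i\<close> in the continuum such that the differences \<open>v i = b i - a i\<close> form a
  basis. A path from \<open>a i\<close> to \<open>b i\<close> close to the continuum extends periodically to a map of the real line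
  at bounded distance from \<open>t \<mapsto> t v i\<close>; the sum of these maps over the coordinates is a bounded
  perturbation of the identity, hence onto by Brouwer's fixed point theorem. So finitely many
  translates of the sum of the continua cover a ball, and the sum has interior points by Baire's theorem.

  If \<open>A\<close> is non-meager in a locally connected nowhere flat continuum and countably many closed sets cover
  the \<open>n\<close>-fold sum of \<open>A\<close>, then one of them contains \<open>V 1 + \<dots> + V n\<close> with relatively open \<open>V i\<close>, thus a sum
  of small continua to which the first part applies, so it has interior points. Hence the \<open>n\<close>-fold sum is
  non-meager. Being analytic it is comeager in some open set (Nikodym), and adding it to itself yields
  interior points (Piccard and Pettis).

  A mid-convex function bounded above on \<open>T\<close> is bounded above by the same constant on the average of
  \<open>2^k\<close> copies of \<open>T\<close>; if that has interior points, the function is continuous by the theorem of Bernstein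
  and Doetsch.\<close>

section \<open>Sums of sets\<close>

lemma sum_lessThan_add:
  fixes g :: "nat \<Rightarrow> 'a::comm_monoid_add"
  shows "(\<Sum>i<m+n. g i) = (\<Sum>i<m. g i) + (\<Sum>i<n. g (m + i))"
  by (induction n) (simp_all add: add.assoc)

lemma nfold_sum_add:
  "nfold_sum (m + n) T = {x + y | x y. x \<in> nfold_sum m T \<and> y \<in> nfold_sum n T}"
proof (intro equalityI subsetI)
  fix z assume "z \<in> nfold_sum (m + n) T"
  then obtain t where t: "\<forall>i<m+n. t i \<in> T" "z = (\<Sum>i<m+n. t i)"
    unfolding nfold_sum_def by blast
  have "(\<Sum>i<m. t i) \<in> nfold_sum m T"
    unfolding nfold_sum_def using t(1) by auto
  moreover have "(\<Sum>i<n. t (m + i)) \<in> nfold_sum n T"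
    unfolding nfold_sum_def using t(1) by auto
  ultimately show "z \<in> {x + y | x y. x \<in> nfold_sum m T \<and> y \<in> nfold_sum n T}"
    using t(2) by (auto simp: sum_lessThan_add)
next
  fix z assume "z \<in> {x + y | x y. x \<in> nfold_sum m T \<and> y \<in> nfold_sum n T}"
  then obtain s t where st: "\<forall>i<m. s i \<in> T" "\<forall>i<n. t i \<in> T"
      "z = (\<Sum>i<m. s i) + (\<Sum>i<n. t i)"
    unfolding nfold_sum_def by blast
  define r where "r i = (if i < m then s i else t (i - m))" for i
  have "z = (\<Sum>i<m+n. r i)"
    unfolding sum_lessThan_add by (simp add: r_def st(3))
  moreover have "\<forall>i<m+n. r i \<in> T"
    using st by (auto simp: r_def)
  ultimately show "z \<in> nfold_sum (m + n) T"
    unfolding nfold_sum_def by blast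
qed

lemma nfold_sum_1 [simp]: "nfold_sum (Suc 0) T = T"
  unfolding nfold_sum_def by auto

text \<open>Adding \<open>n\<close> copies of one fixed point \<open>c\<close> of \<open>T\<close>
  translates the \<open>m\<close>-fold sum into the \<open>p\<close>-fold sum, where
  \<open>p = m + n\<close>; translation preserves interior points.\<close>

lemma interior_nfold_sum_mono:
  fixes T :: "'a::real_normed_vector set"
  assumes "interior (nfold_sum m T) \<noteq> {}" "0 < m" "m \<le> p"
  shows "interior (nfold_sum p T) \<noteq> {}"
proof -
  obtain n where p: "p = m + n"
    using \<open>m \<le> p\<close> le_Suc_ex by blast
  obtain x where "x \<in> nfold_sum m T"
    using assms(1) interior_subset by blast
  then obtain c where "c \<in> T"
    using \<open>0 < m\<close> unfolding nfold_sum_def by blast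
  define d where "d = (\<Sum>i<n. c)"
  have "d \<in> nfold_sum n T"
    unfolding nfold_sum_def d_def using \<open>c \<in> T\<close> by blast
  then have "(+) d ` nfold_sum m T \<subseteq> nfold_sum p T"
    unfolding p nfold_sum_add by (force simp: add.commute)
  then have "interior ((+) d ` nfold_sum m T) \<subseteq> interior (nfold_sum p T)"
    by (rule interior_mono)
  then show ?thesis
    using assms(1) by (auto simp: interior_translation)
qed

text \<open>The summands may come from different sets, because the small continua found inside
  \<open>K\<close> later on sit in different relatively open sets.\<close>

definition sums_of :: "nat \<Rightarrow> (nat \<Rightarrow> 'a::comm_monoid_add set) \<Rightarrow> 'a set" where
  "sums_of m V = {(\<Sum>i<m. t i) | t. \<forall>i<m. t i \<in> V i}"

lemma nfold_sum_eq_sums_of: "nfold_sum m T = sums_of m (\<lambda>_. T)"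
  unfolding nfold_sum_def sums_of_def ..

lemma sums_of_0 [simp]: "sums_of 0 V = {0}"
  by (simp add: sums_of_def)

lemma sums_of_Suc: "sums_of (Suc m) V = {x + y | x y. x \<in> sums_of m V \<and> y \<in> V m}"
proof (intro equalityI subsetI)
  fix z assume "z \<in> sums_of (Suc m) V"
  then obtain t where "\<forall>i<Suc m. t i \<in> V i" "z = (\<Sum>i<m. t i) + t m"
    unfolding sums_of_def by auto
  then show "z \<in> {x + y | x y. x \<in> sums_of m V \<and> y \<in> V m}"
    unfolding sums_of_def using less_Suc_eq by blast
next
  fix z assume "z \<in> {x + y | x y. x \<in> sums_of m V \<and> y \<in> V m}"
  then obtain t y where ty: "\<forall>i<m. t i \<in> V i" "y \<in> V m" "z = (\<Sum>i<m. t i) + y"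
    unfolding sums_of_def by blast
  have "z = (\<Sum>i<Suc m. (t(m := y)) i)"
    by (simp add: ty(3))
  moreover have "\<forall>i<Suc m. (t(m := y)) i \<in> V i"
    using ty by (simp add: less_Suc_eq)
  ultimately show "z \<in> sums_of (Suc m) V"
    unfolding sums_of_def by blast
qed

lemma sums_of_mono:
  assumes "\<And>i. i < m \<Longrightarrow> V i \<subseteq> W i"
  shows "sums_of m V \<subseteq> sums_of m W"
  unfolding sums_of_def using assms by blast

lemma compact_sums_of:
  fixes V :: "nat \<Rightarrow> 'a::real_normed_vector set"
  assumes "\<And>i. i < m \<Longrightarrow> compact (V i)"
  shows "compact (sums_of m V)"
  using assms by (induction m) (simp_all add: sums_of_Suc compact_sums)

section \<open>Mid-convex functions\<close>

lemma dyadic_combination_in_convex: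
  assumes "convex D" "x \<in> D" "y \<in> D"
  shows "y + (x - y) /\<^sub>R 2 ^ k \<in> D"
proof -
  have "(1 - 1 / 2 ^ k) *\<^sub>R y + (1 / 2 ^ k) *\<^sub>R x \<in> D"
    using assms by (intro convexD) (auto simp: field_simps)
  then show ?thesis by (simp add: algebra_simps divide_inverse)
qed

text \<open>Each point is the midpoint of \<open>y\<close> and the preceding one, so every
  application of mid-convexity halves the excess over \<open>f y\<close>.\<close>

lemma mid_convex_on_dyadic:
  assumes "mid_convex_on D f" "convex D" "x \<in> D" "y \<in> D"
  shows "f (y + (x - y) /\<^sub>R 2 ^ k) \<le> f y + (f x - f y) / 2 ^ k"
proof (induction k)
  case (Suc k)
  let ?w = "y + (x - y) /\<^sub>R 2 ^ k"
  have "y + (x - y) /\<^sub>R 2 ^ Suc k = (y + ?w) /\<^sub>R 2"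
    by (simp add: algebra_simps flip: scaleR_2)
  moreover have "f ((y + ?w) /\<^sub>R 2) \<le> (f y + f ?w) / 2"
    using assms(1,4) dyadic_combination_in_convex[OF assms(2-4)] unfolding mid_convex_on_def by blast
  ultimately have "f (y + (x - y) /\<^sub>R 2 ^ Suc k) \<le> (f y + f ?w) / 2" by (simp only:)
  also have "\<dots> \<le> (f y + (f y + (f x - f y) / 2 ^ k)) / 2"
    by (intro divide_right_mono add_left_mono Suc.IH) simp
  also have "\<dots> = f y + (f x - f y) / 2 ^ Suc k"
    by (simp add: field_simps)
  finally show ?case .
qed simp

text \<open>Prolong the segment from \<open>c\<close> through \<open>y\<close> slightly to a point
  \<open>z\<close> of \<open>D\<close>, so that \<open>y\<close> divides the segment from
  \<open>z\<close> to \<open>c\<close> in a dyadic ratio. The contraction with centre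
  \<open>z\<close> and this ratio carries the ball about \<open>c\<close> to a ball about
  \<open>y\<close>, and dyadic convexity carries the bound along.\<close>

lemma mid_convex_on_locally_bdd_above:
  fixes f :: "'a::real_normed_vector \<Rightarrow> real"
  assumes f: "mid_convex_on D f" and D: "open D" "convex D"
    and r: "0 < r" "ball c r \<subseteq> D" "\<And>x. x \<in> ball c r \<Longrightarrow> f x \<le> M"
    and y: "y \<in> D"
  shows "\<exists>s>0. ball y s \<subseteq> D \<and> (\<exists>N. \<forall>x\<in>ball y s. f x \<le> N)"
proof -
  obtain e where e: "0 < e" "ball y e \<subseteq> D"
    using D y openE by blast
  \<comment> \<open>The prolongation has length \<open>norm (y - c) / (q - 1)\<close> with
    \<open>q = 2 ^ k\<close>; this \<open>k\<close> makes it smaller than \<open>e\<close>, which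
    keeps \<open>z\<close> in \<open>D\<close>.\<close>
  obtain k where k: "norm (y - c) / e + 1 < 2 ^ k"
    using real_arch_pow[of 2] by auto
  define q :: real where "q = 2 ^ k"
  have q: "q > 1" "norm (y - c) / e + 1 < q"
    using k e by (auto simp: q_def add_nonneg_pos intro: le_less_trans[rotated])
  define z where "z = y + (y - c) /\<^sub>R (q - 1)"
  have "norm (y - c) / (q - 1) < e"
    using q e by (simp add: field_simps)
  then have "z \<in> ball y e"
    using q by (simp add: z_def dist_norm divide_inverse mult.commute)
  then have z: "z \<in> D" using e by blast
  have yz: "q *\<^sub>R (y - z) + z = c"
  proof -
    have "q *\<^sub>R (y - z) + z = y - (q - 1) *\<^sub>R (z - y)" by (simp add: algebra_simps)
    also have "(q - 1) *\<^sub>R (z - y) = y - c" using q by (simp add: z_def)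
    finally show ?thesis by simp
  qed
  have *: "w \<in> D \<and> f w \<le> f z + (M - f z) / q" if w: "w \<in> ball y (r / q)" for w
  proof -
    define x where "x = z + q *\<^sub>R (w - z)"
    have "x - c = q *\<^sub>R (w - y)"
      unfolding x_def yz[symmetric] by (simp add: algebra_simps)
    then have "norm (x - c) = q * norm (w - y)"
      using q by simp
    also have "\<dots> < r"
      using w q by (simp add: dist_norm norm_minus_commute field_simps)
    finally have "norm (x - c) < r" .
    then have "x \<in> ball c r"
      by (simp add: dist_norm norm_minus_commute)
    moreover have "w = z + (x - z) /\<^sub>R q"
      using q by (simp add: x_def)
    moreover from calculation have "x \<in> D" "f x \<le> M" using r by auto
    moreover from this have "(f x - f z) / q \<le> (M - f z) / q"
      using q by (intro divide_right_mono) auto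
    ultimately show ?thesis
      using mid_convex_on_dyadic[OF f D(2), of x z k] dyadic_combination_in_convex[OF D(2), of x z k] z
      unfolding q_def[symmetric] by auto
  qed
  have "ball y (r / q) \<subseteq> D" "\<forall>x\<in>ball y (r / q). f x \<le> f z + (M - f z) / q"
    using * by auto
  moreover have "0 < r / q" using r(1) q by simp
  ultimately show ?thesis by blast
qed

text \<open>Local boundedness from above spreads from \<open>U\<close> to every point
  \<open>y\<close> of \<open>D\<close>. Dyadic convexity turns such a bound into an upper estimate
  of \<open>f (y + h) - f y\<close> that tends to zero with \<open>h\<close>, and reflection in
  \<open>y\<close> turns the upper estimate into a lower one.\<close>

theorem Bernstein_Doetsch:
  fixes f :: "'a::real_normed_vector \<Rightarrow> real"
  assumes f: "mid_convex_on D f" and D: "open D" "convex D"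
    and U: "open U" "U \<noteq> {}" "U \<subseteq> D" "\<And>x. x \<in> U \<Longrightarrow> f x \<le> M"
  shows "continuous_on D f"
proof -
  obtain c r where c: "0 < r" "ball c r \<subseteq> U"
    using U(1,2) openE by blast
  have cD: "ball c r \<subseteq> D" and cM: "\<And>x. x \<in> ball c r \<Longrightarrow> f x \<le> M"
    using c U by auto
  have "isCont f y" if y: "y \<in> D" for y
  proof -
    obtain s N where s: "0 < s" "ball y s \<subseteq> D" "\<And>x. x \<in> ball y s \<Longrightarrow> f x \<le> N"
      using mid_convex_on_locally_bdd_above[OF f D c(1) cD cM y] by blast
    \<comment> \<open>The point \<open>y + h\<close> divides the segment from \<open>y\<close> to
      \<open>y + 2 ^ k *\<^sub>R h\<close> in the ratio needed for dyadic convexity, and the far end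
      still lies in the ball where \<open>f\<close> is at most \<open>N\<close>.\<close>
    have up: "f (y + h) - f y \<le> (N - f y) / 2 ^ k" if h: "norm h < s / 2 ^ k" for h k
    proof -
      have "y + 2 ^ k *\<^sub>R h \<in> ball y s"
        using h by (simp add: dist_norm field_simps)
      then have "y + 2 ^ k *\<^sub>R h \<in> D" "f (y + 2 ^ k *\<^sub>R h) \<le> N"
        using s by auto
      moreover from this have "(f (y + 2 ^ k *\<^sub>R h) - f y) / 2 ^ k \<le> (N - f y) / 2 ^ k"
        by (intro divide_right_mono) auto
      ultimately show ?thesis
        using mid_convex_on_dyadic[OF f D(2), of "y + 2 ^ k *\<^sub>R h" y k] y by simp
    qed
    \<comment> \<open>Since \<open>y\<close> is the midpoint of \<open>y + h\<close> and
      \<open>y - h\<close>, the drop of \<open>f\<close> at \<open>y + h\<close> is at most its rise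
      at \<open>y - h\<close>.\<close>
    have lo: "f y - f (y + h) \<le> (N - f y) / 2 ^ k" if h: "norm h < s / 2 ^ k" for h k
    proof -
      have "s / 2 ^ k \<le> s" using s(1) by (simp add: field_simps)
      then have "y + h \<in> D" "y - h \<in> D"
        using s(2) h by (auto simp: subset_iff dist_norm)
      then have "f (((y + h) + (y - h)) /\<^sub>R 2) \<le> (f (y + h) + f (y - h)) / 2"
        using f unfolding mid_convex_on_def by blast
      moreover have "((y + h) + (y - h)) /\<^sub>R 2 = y" by (simp flip: scaleR_2)
      ultimately show ?thesis
        using up[of "- h" k] h by simp
    qed
    have Ny: "N - f y \<ge> 0" using s by (simp add: s(3))
    show ?thesis
      unfolding continuous_at_eps_delta
    proof (intro allI impI)
      fix e :: real assume "e > 0"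
      obtain k where k: "(N - f y) / e < 2 ^ k" using real_arch_pow[of 2] by auto
      show "\<exists>d>0. \<forall>x'. dist x' y < d \<longrightarrow> dist (f x') (f y) < e"
      proof (intro exI[of _ "s / 2 ^ k"] conjI allI impI)
        fix x assume "dist x y < s / 2 ^ k"
        then have "\<bar>f x - f y\<bar> \<le> (N - f y) / 2 ^ k"
          using up[of "x - y" k] lo[of "x - y" k] by (simp add: dist_norm abs_le_iff)
        moreover have "(N - f y) / 2 ^ k < e"
          using k \<open>e > 0\<close> by (simp add: field_simps)
        ultimately show "dist (f x) (f y) < e" by (simp add: dist_real_def)
      qed (use s in simp)
    qed
  qed
  then show ?thesis
    by (simp add: continuous_at_imp_continuous_on)
qed

text \<open>Halving a sum of \<open>2 ^ (k + 1)\<close> terms gives the midpoint of two averages of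
  \<open>2 ^ k\<close> terms, so the bound \<open>M\<close> survives each doubling.\<close>

lemma mid_convex_on_nfold_sum_le:
  assumes f: "mid_convex_on D f" and D: "convex D" "T \<subseteq> D"
    and M: "\<And>t. t \<in> T \<Longrightarrow> f t \<le> M"
    and x: "x \<in> nfold_sum (2 ^ k) T"
  shows "x /\<^sub>R 2 ^ k \<in> D \<and> f (x /\<^sub>R 2 ^ k) \<le> M"
  using x
proof (induction k arbitrary: x)
  case (Suc k)
  have "x \<in> nfold_sum (2 ^ k + 2 ^ k) T"
    using Suc.prems by (simp add: mult_2)
  then obtain u v where uv: "x = u + v" "u \<in> nfold_sum (2 ^ k) T" "v \<in> nfold_sum (2 ^ k) T"
    unfolding nfold_sum_add by blast
  let ?u = "u /\<^sub>R 2 ^ k" and ?v = "v /\<^sub>R 2 ^ k"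
  have x: "x /\<^sub>R 2 ^ Suc k = (?u + ?v) /\<^sub>R 2"
    by (simp add: uv scaleR_add_right)
  have "inverse 2 *\<^sub>R ?u + inverse 2 *\<^sub>R ?v \<in> D"
    by (intro convexD[OF D(1)]) (use Suc.IH uv in auto)
  then have "(?u + ?v) /\<^sub>R 2 \<in> D"
    by (simp only: scaleR_add_right)
  moreover have "f ((?u + ?v) /\<^sub>R 2) \<le> M"
  proof -
    have "f ((?u + ?v) /\<^sub>R 2) \<le> (f ?u + f ?v) / 2"
      using f Suc.IH uv unfolding mid_convex_on_def by blast
    also have "\<dots> \<le> (M + M) / 2"
      by (intro divide_right_mono add_mono) (use Suc.IH uv in auto)
    finally show ?thesis by simp
  qed
  ultimately show ?case unfolding x by (rule conjI)
qed (use D M in auto)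

text \<open>The bound on averages is available for powers of two, so the \<open>m\<close>-fold sum
  is first enlarged to the \<open>2 ^ m\<close>-fold one. Its rescaled interior is an open set on
  which the function is bounded above.\<close>

lemma class_A_if_interior_nfold_sum:
  fixes T :: "'a::real_normed_vector set"
  assumes "interior (nfold_sum m T) \<noteq> {}" "0 < m"
  shows "T \<in> class_A"
  unfolding class_A_def
proof (intro CollectI allI impI, elim conjE)
  fix D and f :: "'a \<Rightarrow> real"
  assume D: "open D" "convex D" "T \<subseteq> D" and f: "mid_convex_on D f" and "bdd_above (f ` T)"
  then obtain M where M: "\<And>t. t \<in> T \<Longrightarrow> f t \<le> M"
    by (auto simp: bdd_above_def)
  define S where "S = (\<lambda>x. x /\<^sub>R 2 ^ m) ` interior (nfold_sum (2 ^ m) T)"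
  have S: "s \<in> D \<and> f s \<le> M" if "s \<in> S" for s
    using that mid_convex_on_nfold_sum_le[OF f D(2,3) M, of _ m] interior_subset
    unfolding S_def by blast
  show "continuous_on D f"
  proof (rule Bernstein_Doetsch[OF f D(1,2), of S M])
    show "open S" unfolding S_def by (intro open_scaling) auto
    show "S \<noteq> {}" unfolding S_def
      using interior_nfold_sum_mono[OF assms, of "2 ^ m"] by (simp add: less_imp_le)
  qed (use S in auto)
qed

text \<open>An additive function satisfies the midpoint condition with equality, so it is mid-convex
  on the convex open set \<open>UNIV\<close>.\<close>

lemma class_A_subset_class_B: "class_A \<subseteq> (class_B :: 'a::real_normed_vector set set)"
proof (unfold class_B_def, safe)
  fix T :: "'a set" and f :: "'a \<Rightarrow> real"
  assume T: "T \<in> class_A" and f: "Modules.additive f" and "bdd_above (f ` T)"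
  have "f ((x + y) /\<^sub>R 2) = (f x + f y) / 2" for x y
  proof -
    let ?m = "(x + y) /\<^sub>R 2"
    have "f (?m + ?m) = f ?m + f ?m" using f by (rule additive.add)
    moreover have "?m + ?m = x + y" by (simp flip: scaleR_2)
    ultimately show ?thesis using additive.add[OF f, of x y] by simp
  qed
  then have "mid_convex_on UNIV f" by (simp add: mid_convex_on_def)
  then show "continuous_on UNIV f"
    using T \<open>bdd_above (f ` T)\<close> unfolding class_A_def by fastforce
qed

section \<open>Meager sets\<close>

lemma nowhere_dense_in_subset:
  "nowhere_dense_in X T \<Longrightarrow> S \<subseteq> T \<Longrightarrow> nowhere_dense_in X S"
  unfolding nowhere_dense_in_def
  by (metis (no_types, lifting) closure_of_mono interior_of_mono subset_empty subset_trans)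

lemma nowhere_dense_in_imp_meager_in: "nowhere_dense_in X S \<Longrightarrow> meager_in X S"
  unfolding meager_in_def by (rule exI[of _ "{S}"]) auto

lemma meager_in_subset:
  assumes "meager_in X T" "S \<subseteq> T"
  shows "meager_in X S"
proof -
  obtain \<N> where \<N>: "countable \<N>" "\<forall>N\<in>\<N>. nowhere_dense_in X N" "T = \<Union>\<N>"
    using assms(1) unfolding meager_in_def by blast
  show ?thesis
    unfolding meager_in_def
  proof (intro exI[of _ "(\<inter>) S ` \<N>"] conjI)
    show "\<forall>N\<in>(\<inter>) S ` \<N>. nowhere_dense_in X N"
      using \<N>(2) nowhere_dense_in_subset by blast
  qed (use \<N> assms(2) in auto)
qed

lemma meager_in_Union:
  assumes "countable \<F>" "\<And>S. S \<in> \<F> \<Longrightarrow> meager_in X S"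
  shows "meager_in X (\<Union>\<F>)"
proof -
  have "\<forall>S\<in>\<F>. \<exists>\<N>. countable \<N> \<and> (\<forall>N\<in>\<N>. nowhere_dense_in X N) \<and> S = \<Union>\<N>"
    using assms(2) unfolding meager_in_def by blast
  from bchoice[OF this] obtain \<N>
    where \<N>: "\<forall>S\<in>\<F>. countable (\<N> S) \<and> (\<forall>N\<in>\<N> S. nowhere_dense_in X N) \<and> S = \<Union>(\<N> S)"
    by blast
  show ?thesis
    unfolding meager_in_def
  proof (intro exI[of _ "\<Union>(\<N> ` \<F>)"] conjI)
    show "countable (\<Union>(\<N> ` \<F>))"
      using \<N> assms(1) by (intro countable_UN) auto
    show "\<Union>\<F> = \<Union>(\<Union>(\<N> ` \<F>))"
    proof -
      have "(\<Union>S\<in>\<F>. S) = (\<Union>S\<in>\<F>. \<Union>(\<N> S))"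
        by (rule SUP_cong) (use \<N> in blast)+
      then show ?thesis by auto
    qed
  qed (use \<N> in blast)
qed

lemma meager_in_UN:
  assumes "countable I" "\<And>i. i \<in> I \<Longrightarrow> meager_in X (S i)"
  shows "meager_in X (\<Union>i\<in>I. S i)"
  by (rule meager_in_Union) (use assms in auto)

lemma meager_in_Un: "meager_in X S \<Longrightarrow> meager_in X T \<Longrightarrow> meager_in X (S \<union> T)"
  using meager_in_Union[of "{S, T}" X] by fastforce

lemma meager_in_closed_cover:
  assumes "meager_in X S"
  shows "\<exists>\<C>. countable \<C> \<and> (\<forall>C\<in>\<C>. closedin X C \<and> X interior_of C = {}) \<and> S \<subseteq> \<Union>\<C>"
proof -
  obtain \<N> where \<N>: "countable \<N>" "\<forall>N\<in>\<N>. nowhere_dense_in X N" "S = \<Union>\<N>"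
    using assms unfolding meager_in_def by blast
  show ?thesis
  proof (intro exI[of _ "(\<lambda>N. X closure_of N) ` \<N>"] conjI)
    show "S \<subseteq> \<Union>((\<lambda>N. X closure_of N) ` \<N>)"
      using \<N> closure_of_subset unfolding nowhere_dense_in_def by fastforce
  qed (use \<N> in \<open>auto simp: nowhere_dense_in_def\<close>)
qed

text \<open>A closed set without interior points is nowhere dense, and countably many of these cover
  only meager sets.\<close>

lemma non_meager_in_imp_interior_of:
  assumes "\<not> meager_in X A" "countable \<C>" "\<And>C. C \<in> \<C> \<Longrightarrow> closedin X C" "A \<subseteq> \<Union>\<C>"
  shows "\<exists>C\<in>\<C>. X interior_of C \<noteq> {}"
proof (rule ccontr)
  assume "\<not> ?thesis"
  then have "nowhere_dense_in X C" if "C \<in> \<C>" for C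
    using that assms(3)[OF that] unfolding nowhere_dense_in_def
    by (metis closedin_subset closure_of_eq)
  then have "meager_in X (\<Union>\<C>)"
    using assms(2) by (intro meager_in_Union nowhere_dense_in_imp_meager_in)
  then show False
    using assms(1,4) meager_in_subset by blast
qed

lemma nowhere_dense_in_euclidean_iff:
  "nowhere_dense_in euclidean S \<longleftrightarrow> interior (closure S) = {}"
  by (simp add: nowhere_dense_in_def)

lemma meager_in_euclidean_open_empty:
  fixes W :: "'a::complete_space set"
  assumes "meager_in euclidean W" "open W"
  shows "W = {}"
proof -
  obtain \<C> where \<C>: "countable \<C>"
      "\<forall>C\<in>\<C>. closedin euclidean C \<and> euclidean interior_of C = {}" "W \<subseteq> \<Union>\<C>"
    using meager_in_closed_cover[OF assms(1)] by blast
  have "euclidean interior_of \<Union>\<C> = {}"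
    using \<C> by (intro Baire_category_alt) (auto simp: completely_metrizable_space_euclidean)
  then show ?thesis
    using \<C>(3) assms(2) by (metis interior_of_maximal open_openin subset_empty)
qed

lemma meager_in_closure_diff_open:
  fixes W :: "'a::topological_space set"
  assumes "open W"
  shows "meager_in euclidean (closure W - W)"
proof (rule nowhere_dense_in_imp_meager_in)
  have "closed (closure W - W)"
    using assms by (simp add: closed_Diff)
  moreover have "interior (closure W - W) = {}"
  proof (rule ccontr)
    assume "interior (closure W - W) \<noteq> {}"
    then obtain x V where V: "open V" "x \<in> V" "V \<subseteq> closure W - W"
      by (metis ex_in_conv interior_subset open_interior)
    then have "V \<inter> W \<noteq> {}"
      using open_Int_closure_eq_empty[of V W] by blast
    then show False using V by blast
  qed
  ultimately show "nowhere_dense_in euclidean (closure W - W)"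
    by (simp add: nowhere_dense_in_euclidean_iff)
qed

section \<open>Localization of category\<close>

definition meager_part :: "'a::topological_space set \<Rightarrow> 'a set" where
  "meager_part S = \<Union>{B. open B \<and> meager_in euclidean (S \<inter> B)}"

text \<open>This is the interior of the set of points at which \<open>S\<close> is non-meager in
  every neighbourhood.\<close>

definition nonmeager_core :: "'a::topological_space set \<Rightarrow> 'a set" where
  "nonmeager_core S = - closure (meager_part S)"

lemma open_meager_part: "open (meager_part S)"
  unfolding meager_part_def by auto

lemma open_nonmeager_core: "open (nonmeager_core S)"
  unfolding nonmeager_core_def by auto

text \<open>This is Banach's category theorem; the Lindelof property reduces the possibly
  uncountable union of open sets to a countable one.\<close>

lemma meager_in_Int_meager_part:
  fixes S :: "'a::second_countable_topology set"
  shows "meager_in euclidean (S \<inter> meager_part S)"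
proof -
  define \<F> where "\<F> = {B. open B \<and> meager_in euclidean (S \<inter> B)}"
  have "open B" if "B \<in> \<F>" for B
    using that by (simp add: \<F>_def)
  then obtain \<B> where \<B>: "\<B> \<subseteq> \<F>" "countable \<B>" "\<Union>\<B> = \<Union>\<F>"
    by (rule Lindelof)
  have "meager_in euclidean (\<Union>B\<in>\<B>. S \<inter> B)"
    using \<B>(1,2) by (intro meager_in_UN) (auto simp: \<F>_def)
  then show ?thesis
    unfolding meager_part_def \<F>_def[symmetric] \<B>(3)[symmetric] by (simp only: Int_Union)
qed

text \<open>Outside its core, \<open>S\<close> lies in \<open>meager_part S\<close>, where it is
  meager, or on the boundary of this open set, which is nowhere dense.\<close>

lemma meager_in_diff_nonmeager_core:
  fixes S :: "'a::second_countable_topology set"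
  shows "meager_in euclidean (S - nonmeager_core S)"
proof (rule meager_in_subset)
  show "meager_in euclidean
          ((S \<inter> meager_part S) \<union> (closure (meager_part S) - meager_part S))"
    by (intro meager_in_Un meager_in_Int_meager_part meager_in_closure_diff_open open_meager_part)
qed (auto simp: nonmeager_core_def)

lemma nonmeager_core_Int_open:
  assumes "open N" "meager_in euclidean (S \<inter> N)"
  shows "nonmeager_core S \<inter> N = {}"
proof -
  have "N \<subseteq> meager_part S"
    using assms unfolding meager_part_def by blast
  then show ?thesis
    using closure_subset[of "meager_part S"] unfolding nonmeager_core_def by blast
qed

lemma nonmeager_core_subset_closure: "nonmeager_core S \<subseteq> closure S"
proof -
  have "S \<inter> - closure S = {}"
    using closure_subset by blast
  moreover have "meager_in euclidean {}"
    unfolding meager_in_def by (rule exI[of _ "{}"]) auto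
  ultimately have "nonmeager_core S \<inter> - closure S = {}"
    by (intro nonmeager_core_Int_open) auto
  then show ?thesis by blast
qed

text \<open>Away from the closure of the union \<open>G\<close> of all cores every member of the
  family is meager, hence so is the union of the family. Its core therefore lies in the closure of
  \<open>G\<close>, and only the nowhere dense boundary of \<open>G\<close> can remain
  uncovered.\<close>

lemma meager_in_nonmeager_core_Union_diff:
  fixes \<S> :: "'a::second_countable_topology set set"
  assumes "countable \<S>"
  shows "meager_in euclidean (nonmeager_core (\<Union>\<S>) - (\<Union>S\<in>\<S>. nonmeager_core S))"
proof -
  define G where "G = (\<Union>S\<in>\<S>. nonmeager_core S)"
  have G: "open G"
    unfolding G_def by (auto intro: open_nonmeager_core)
  have "meager_in euclidean (\<Union>S\<in>\<S>. S - nonmeager_core S)"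
    using assms by (intro meager_in_UN meager_in_diff_nonmeager_core)
  then have "meager_in euclidean (\<Union>\<S> \<inter> - closure G)"
    by (rule meager_in_subset) (use closure_subset[of G] in \<open>auto simp: G_def\<close>)
  then have "nonmeager_core (\<Union>\<S>) \<inter> - closure G = {}"
    by (intro nonmeager_core_Int_open) auto
  then have "nonmeager_core (\<Union>\<S>) - G \<subseteq> closure G - G"
    by blast
  then show ?thesis
    using meager_in_closure_diff_open[OF G] meager_in_subset unfolding G_def by blast
qed

section \<open>Analytic sets\<close>

text \<open>This is Nikodym's theorem that analytic sets have the Baire property, in the form needed here.
  The core of the image of a basic open set is covered, up to a meager set, by the cores of the images
  of its small basic open subsets. A point outside all these countably many meager sets thus lies in
  the cores of the images of a decreasing sequence of sets whose diameters tend to zero, and the limit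
  of that sequence is a preimage.\<close>
theorem polish_image_comeager_in_open:
  fixes f :: "'b \<Rightarrow> 'a::{second_countable_topology,t2_space}"
  assumes "polish X" and f: "continuous_map X euclidean f"
    and nonmeager: "\<not> meager_in euclidean (f ` topspace X)"
  obtains W where "open W" "W \<noteq> {}" "meager_in euclidean (W - f ` topspace X)"
proof -
  have "completely_metrizable_space X"
    using \<open>polish X\<close> by (simp add: polish_def)
  then obtain M d where Md: "Metric_space M d" "Metric_space.mcomplete M d"
      and X: "X = Metric_space.mtopology M d"
    unfolding completely_metrizable_space_def by blast
  interpret Metric_space M d by fact
  have tX: "topspace X = M" by (simp add: X)
  obtain \<B> where "countable \<B>" and \<B>: "\<And>V. V \<in> \<B> \<Longrightarrow> openin X V"
    and base: "\<And>U x. openin X U \<Longrightarrow> x \<in> U \<Longrightarrow> \<exists>V\<in>\<B>. x \<in> V \<and> V \<subseteq> U"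
    using \<open>polish X\<close> unfolding polish_def second_countable_def by metis
  define cover where
    "cover U m = {V \<in> \<B>. V \<subseteq> U \<and> (\<exists>c\<in>M. V \<subseteq> mball c (1 / real (Suc m)))}" for U and m :: nat
  have cover: "\<Union>(cover U m) = U" if "openin X U" for U m
  proof
    show "U \<subseteq> \<Union>(cover U m)"
    proof
      fix x assume x: "x \<in> U"
      then have "x \<in> M" using that tX openin_subset by blast
      moreover have "openin X (U \<inter> mball x (1 / real (Suc m)))"
        using that by (auto simp: X)
      ultimately obtain V where "V \<in> \<B>" "x \<in> V" "V \<subseteq> U \<inter> mball x (1 / real (Suc m))"
        using base[of "U \<inter> mball x (1 / real (Suc m))" x] x by auto
      with \<open>x \<in> M\<close> show "x \<in> \<Union>(cover U m)"
        unfolding cover_def by blast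
    qed
  qed (auto simp: cover_def)
  define bad where
    "bad U m = nonmeager_core (f ` U) - (\<Union>V\<in>cover U m. nonmeager_core (f ` V))" for U m
  have bad: "meager_in euclidean (bad U m)" if "openin X U" for U m
  proof -
    have "countable (cover U m)"
      unfolding cover_def using \<open>countable \<B>\<close> by simp
    then have "meager_in euclidean (nonmeager_core (\<Union>((`) f ` cover U m)) -
        (\<Union>S\<in>(`) f ` cover U m. nonmeager_core S))"
      by (intro meager_in_nonmeager_core_Union_diff) simp
    moreover have "\<Union>((`) f ` cover U m) = f ` U"
      unfolding image_Union[symmetric] cover[OF that] ..
    ultimately show ?thesis
      by (simp add: bad_def image_image)
  qed
  define E where "E = (\<Union>U\<in>insert M \<B>. \<Union>m. bad U m)"
  have opens: "openin X U" if "U \<in> insert M \<B>" for U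
    using that \<B> tX by (metis insertE openin_topspace)
  have E: "meager_in euclidean E"
    unfolding E_def using \<open>countable \<B>\<close> bad opens by (intro meager_in_UN) auto
  define W where "W = nonmeager_core (f ` M)"
  have "W - f ` M \<subseteq> E"
  proof (rule subsetI, rule ccontr)
    fix x assume x: "x \<in> W - f ` M" "x \<notin> E"
    have step: "\<exists>V. (V \<in> insert M \<B> \<and> x \<in> nonmeager_core (f ` V)) \<and> V \<in> cover U m"
      if U: "U \<in> insert M \<B> \<and> x \<in> nonmeager_core (f ` U)" for U m
    proof -
      have "x \<notin> bad U m" using x(2) U unfolding E_def by blast
      then obtain V where "V \<in> cover U m" "x \<in> nonmeager_core (f ` V)"
        using U unfolding bad_def by blast
      then show ?thesis unfolding cover_def by blast
    qed
    have "\<exists>U. U \<in> insert M \<B> \<and> x \<in> nonmeager_core (f ` U)"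
      using x unfolding W_def by blast
    then have "\<exists>U. \<forall>m. (U m \<in> insert M \<B> \<and> x \<in> nonmeager_core (f ` U m)) \<and> U (Suc m) \<in> cover (U m) m"
      by (intro dependent_nat_choice step)
    then obtain U where U: "\<And>m. U m \<in> insert M \<B> \<and> x \<in> nonmeager_core (f ` U m)"
      and Usuc: "\<And>m. U (Suc m) \<in> cover (U m) m"
      by blast
    have "decseq U"
      using Usuc by (intro decseq_SucI) (auto simp: cover_def)
    \<comment> \<open>A core is contained in the closure of its set, so a core with a point belongs
      to a nonempty image.\<close>
    have ne: "U m \<noteq> {}" for m
      using U[of m] nonmeager_core_subset_closure[of "f ` U m"] by auto
    have "\<exists>c\<in>M. U (Suc m) \<subseteq> mball c (1 / real (Suc m))" for m
      using Usuc unfolding cover_def by blast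
    then obtain c where c: "\<And>m. c m \<in> M" "\<And>m. U (Suc m) \<subseteq> mball (c m) (1 / real (Suc m))"
      by metis
    define p where "p m = (SOME y. y \<in> U (Suc m))" for m
    have p: "p m \<in> U (Suc m)" for m
      unfolding p_def using ne by (simp add: some_in_eq)
    have near: "d u v < 2 / real (Suc m)" if "u \<in> U (Suc m)" "v \<in> U (Suc m)" for u v m
    proof -
      have uv: "u \<in> M" "v \<in> M" "d (c m) u < 1 / real (Suc m)" "d (c m) v < 1 / real (Suc m)"
        using that c(2)[of m] by auto
      have "d u v \<le> d u (c m) + d (c m) v"
        using uv c(1) by (intro triangle)
      also have "d u (c m) = d (c m) u" by (rule commute)
      finally show ?thesis using uv by simp
    qed
    have small: "\<exists>N. \<forall>m\<ge>N. 2 / real (Suc m) < r" if "r > 0" for r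
    proof -
      obtain N where N: "2 / r < real N" using reals_Archimedean2 by blast
      show ?thesis
      proof (intro exI allI impI)
        fix m assume "N \<le> m"
        then have "2 / r < real (Suc m)" using N by linarith
        then show "2 / real (Suc m) < r"
          using that by (simp add: field_simps)
      qed
    qed
    have pM: "range p \<subseteq> M"
      using p c(2) by fastforce
    have "MCauchy p"
      unfolding MCauchy_def
    proof (intro conjI allI impI pM)
      fix r :: real assume "r > 0"
      then obtain N where N: "\<forall>m\<ge>N. 2 / real (Suc m) < r"
        using small by blast
      have "d (p m) (p n) < r" if "N \<le> m" "N \<le> n" for m n
      proof -
        have "p m \<in> U (Suc N)" "p n \<in> U (Suc N)"
          using p[of m] p[of n] decseqD[OF \<open>decseq U\<close>, of "Suc N" "Suc m"]
            decseqD[OF \<open>decseq U\<close>, of "Suc N" "Suc n"] that by auto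
        then show ?thesis
          using near N by (meson less_trans order_refl)
      qed
      then show "\<exists>N. \<forall>n n'. N \<le> n \<longrightarrow> N \<le> n' \<longrightarrow> d (p n) (p n') < r"
        by blast
    qed
    then obtain q where q: "limitin mtopology p q sequentially"
      using Md(2) unfolding mcomplete_def by blast
    then have "q \<in> M" using limitin_mspace by blast
    then have "f q \<noteq> x" using x by blast
    \<comment> \<open>For large \<open>m\<close> the whole of \<open>U (Suc m)\<close> is mapped
      into \<open>A\<close>. As \<open>x\<close> lies in the core of this image, it lies in the
      closure of \<open>A\<close>, contrary to the disjoint neighbourhood \<open>B\<close>.\<close>
    then obtain A B where AB: "open A" "open B" "f q \<in> A" "x \<in> B" "A \<inter> B = {}"
      by (metis separation_t2)
    have "openin mtopology {y \<in> M. f y \<in> A}"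
      using f AB(1) unfolding continuous_map_def tX X[symmetric] by simp
    then obtain r where r: "r > 0" "mball q r \<subseteq> {y \<in> M. f y \<in> A}"
      using \<open>q \<in> M\<close> AB(3) unfolding openin_mtopology by blast
    obtain N where N: "\<forall>m\<ge>N. 2 / real (Suc m) < r / 2"
      using small[of "r / 2"] r by auto
    have "eventually (\<lambda>m. p m \<in> M \<and> d (p m) q < r / 2) sequentially"
      using q half_gt_zero[OF r(1)] unfolding limitin_metric by blast
    then obtain m where m: "m \<ge> N" "d (p m) q < r / 2"
      unfolding eventually_sequentially by (meson nat_le_linear order_refl)
    have "U (Suc m) \<subseteq> mball q r"
    proof
      fix u assume u: "u \<in> U (Suc m)"
      then have uM: "u \<in> M" using c(2)[of m] by auto
      have "d q u \<le> d q (p m) + d (p m) u"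
        using uM \<open>q \<in> M\<close> pM by (intro triangle) auto
      moreover have "d (p m) u < r / 2"
        using near[OF p u] N m by force
      ultimately show "u \<in> mball q r"
        using m uM \<open>q \<in> M\<close> by (simp add: commute)
    qed
    then have "f ` U (Suc m) \<subseteq> A" using r(2) by blast
    then have "x \<in> closure A"
      using U[of "Suc m"] nonmeager_core_subset_closure closure_mono by blast
    then show False
      using AB open_Int_closure_eq_empty[of B A] by blast
  qed
  then have "meager_in euclidean (W - f ` topspace X)"
    unfolding tX using E meager_in_subset by blast
  moreover have "W \<noteq> {}"
    using nonmeager meager_in_diff_nonmeager_core[of "f ` M"] unfolding W_def tX by auto
  moreover have "open W"
    unfolding W_def by (rule open_nonmeager_core)
  ultimately show thesis using that by blast
qed

section \<open>Sums of analytic sets\<close>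

lemma second_countable_prod_topology:
  assumes "second_countable X" "second_countable Y"
  shows "second_countable (prod_topology X Y)"
proof -
  obtain \<B> where \<B>: "countable \<B>" "\<forall>V\<in>\<B>. openin X V"
      "\<forall>U x. openin X U \<and> x \<in> U \<longrightarrow> (\<exists>V\<in>\<B>. x \<in> V \<and> V \<subseteq> U)"
    using assms(1) unfolding second_countable_def by (elim exE conjE) rule
  obtain \<C> where \<C>: "countable \<C>" "\<forall>V\<in>\<C>. openin Y V"
      "\<forall>U x. openin Y U \<and> x \<in> U \<longrightarrow> (\<exists>V\<in>\<C>. x \<in> V \<and> V \<subseteq> U)"
    using assms(2) unfolding second_countable_def by (elim exE conjE) rule
  show ?thesis
    unfolding second_countable_def
  proof (intro exI[of _ "(\<lambda>(U, V). U \<times> V) ` (\<B> \<times> \<C>)"] conjI allI impI)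
    show "countable ((\<lambda>(U, V). U \<times> V) ` (\<B> \<times> \<C>))"
      using \<B> \<C> by simp
    show "\<forall>V\<in>(\<lambda>(U, V). U \<times> V) ` (\<B> \<times> \<C>). openin (prod_topology X Y) V"
      using \<B> \<C> by (auto simp: openin_prod_Times_iff)
    fix W z assume W: "openin (prod_topology X Y) W \<and> z \<in> W"
    obtain x y where z: "z = (x, y)" by (cases z)
    then obtain U V where UV: "openin X U" "openin Y V" "x \<in> U" "y \<in> V" "U \<times> V \<subseteq> W"
      using W unfolding openin_prod_topology_alt by blast
    then obtain U' V' where "U' \<in> \<B>" "x \<in> U'" "U' \<subseteq> U" "V' \<in> \<C>" "y \<in> V'" "V' \<subseteq> V"
      using \<B>(3) \<C>(3) by meson
    then show "\<exists>V\<in>(\<lambda>(U, V). U \<times> V) ` (\<B> \<times> \<C>). z \<in> V \<and> V \<subseteq> W"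
      using UV(5) z by (intro bexI[of _ "U' \<times> V'"]) auto
  qed
qed

text \<open>The sum is a continuous image of the product of the two Polish spaces. This product
  lives on a type of pairs, and \<open>analyticI\<close> brings it back to the fixed carrier
  type.\<close>

lemma analytic_sums:
  fixes S T :: "'a::real_normed_vector set"
  assumes "analytic S" "analytic T"
  shows "analytic {x + y | x y. x \<in> S \<and> y \<in> T}"
proof -
  obtain X Y :: "(nat \<Rightarrow> real) topology" and f g where
    X: "polish X" "continuous_map X euclidean f" "f ` topspace X = S" and
    Y: "polish Y" "continuous_map Y euclidean g" "g ` topspace Y = T"
    using assms unfolding analytic_def by blast
  define h where "h z = f (fst z) + g (snd z)" for z
  have "polish (prod_topology X Y)"
    using X(1) Y(1)
    by (simp add: polish_def completely_metrizable_space_prod_topology second_countable_prod_topology)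
  moreover have "continuous_map (prod_topology X Y) euclidean h"
  proof -
    have "continuous_map (prod_topology X Y) euclidean (f \<circ> fst)"
      "continuous_map (prod_topology X Y) euclidean (g \<circ> snd)"
      using X(2) Y(2) by (auto intro: continuous_map_compose continuous_map_fst continuous_map_snd)
    then have "continuous_map (prod_topology X Y) euclidean (\<lambda>z. (f \<circ> fst) z + (g \<circ> snd) z)"
      by (rule continuous_map_add)
    then show ?thesis by (simp add: h_def[abs_def] o_def)
  qed
  moreover have "h ` topspace (prod_topology X Y) = {x + y | x y. x \<in> S \<and> y \<in> T}"
    unfolding h_def X(3)[symmetric] Y(3)[symmetric] by force
  ultimately show ?thesis using analyticI by metis
qed

lemma analytic_nfold_sum:
  fixes A :: "'a::real_normed_vector set"
  assumes "analytic A" "0 < m"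
  shows "analytic (nfold_sum m A)"
  using assms(2)
proof (induction m rule: nat_induct_non_zero)
  case (Suc m)
  then show ?case
    using analytic_sums[OF Suc.IH assms(1)] nfold_sum_add[of m 1 A] by simp
qed (simp add: assms(1))

section \<open>The theorem of Piccard and Pettis\<close>

text \<open>A continuous involution is its own continuous inverse, so it preserves nowhere density.
  It is applied to the reflections \<open>y \<mapsto> x - y\<close>.\<close>

lemma meager_in_involution_image:
  fixes g :: "'a::topological_space \<Rightarrow> 'a"
  assumes g: "continuous_on UNIV g" and inv: "\<And>x. g (g x) = x" and S: "meager_in euclidean S"
  shows "meager_in euclidean (g ` S)"
proof -
  obtain \<N> where \<N>: "countable \<N>" "\<forall>N\<in>\<N>. nowhere_dense_in euclidean N" "S = \<Union>\<N>"
    using S unfolding meager_in_def by blast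
  have "nowhere_dense_in euclidean (g ` N)" if N: "N \<in> \<N>" for N
  proof -
    define V where "V = interior (closure (g ` N))"
    have "closed (g -` closure N)"
      using g by (simp add: closed_vimage)
    moreover have "g ` N \<subseteq> g -` closure N"
      using inv closure_subset by auto
    ultimately have "closure (g ` N) \<subseteq> g -` closure N"
      by (simp add: closure_minimal)
    then have "V \<subseteq> g -` closure N"
      using interior_subset unfolding V_def by blast
    then have "g -` V \<subseteq> closure N"
      using inv by (metis subsetD subsetI vimageE vimageI2)
    moreover have "open (g -` V)"
      using g unfolding V_def by (simp add: open_vimage)
    ultimately have "g -` V \<subseteq> interior (closure N)"
      by (rule interior_maximal)
    then have "g -` V = {}"
      using \<N>(2) N by (simp add: nowhere_dense_in_euclidean_iff)
    then have "V = {}"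
      using inv by (metis ex_in_conv vimageI2)
    then show ?thesis
      unfolding nowhere_dense_in_euclidean_iff V_def .
  qed
  then have "meager_in euclidean (\<Union>N\<in>\<N>. g ` N)"
    using \<N>(1) by (intro meager_in_UN nowhere_dense_in_imp_meager_in)
  then show ?thesis by (simp add: \<N>(3) image_Union)
qed

text \<open>Every sum of two points of \<open>W\<close> is already a sum of two points of
  \<open>S\<close>: for such an \<open>x\<close> the open set of all \<open>a\<close> in
  \<open>W\<close> with \<open>x - a\<close> in \<open>W\<close> is nonempty, hence non-meager, and
  only a meager part of it is lost by requiring \<open>a\<close> and \<open>x - a\<close> to be in
  \<open>S\<close>.\<close>

lemma interior_sums_comeager:
  fixes S :: "'a::banach set"
  assumes W: "open W" "W \<noteq> {}" and S: "meager_in euclidean (W - S)"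
  shows "interior {x + y | x y. x \<in> S \<and> y \<in> S} \<noteq> {}"
proof -
  have refl: "meager_in euclidean ((\<lambda>y. x - y) ` (W - S))" for x :: 'a
    by (rule meager_in_involution_image[OF _ _ S]) (auto intro: continuous_intros)
  have "x \<in> {x + y | x y. x \<in> S \<and> y \<in> S}" if x: "x \<in> {x + y | x y. x \<in> W \<and> y \<in> W}" for x
  proof -
    define V where "V = W \<inter> (\<lambda>y. x - y) ` W"
    have "open ((\<lambda>y. x - y) ` W)"
    proof -
      have "(\<lambda>y. x - y) ` W = (+) x ` uminus ` W" by (auto simp: image_image)
      then show ?thesis using W(1) by (simp add: open_translation open_negations)
    qed
    then have "open V" using W(1) by (auto simp: V_def)
    obtain u v where uv: "x = u + v" "u \<in> W" "v \<in> W" using x by blast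
    have "u = x - v" using uv by simp
    then have "u \<in> V" using uv by (auto simp: V_def)
    then have "\<not> meager_in euclidean V"
      using meager_in_euclidean_open_empty[OF _ \<open>open V\<close>] by blast
    then have "\<not> V \<subseteq> (W - S) \<union> (\<lambda>y. x - y) ` (W - S)"
      using meager_in_Un[OF S refl] meager_in_subset by blast
    then obtain a where a: "a \<in> V" "a \<in> S" "a \<notin> (\<lambda>y. x - y) ` (W - S)"
      by (auto simp: V_def)
    then obtain b where b: "b \<in> W" "a = x - b" by (auto simp: V_def)
    then have "b \<in> S" using a(3) by blast
    moreover have "x = a + b" using b by simp
    ultimately show ?thesis using a(2) by blast
  qed
  then have "{x + y | x y. x \<in> W \<and> y \<in> W} \<subseteq> {x + y | x y. x \<in> S \<and> y \<in> S}"
    by blast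
  moreover have "open {x + y | x y. x \<in> W \<and> y \<in> W}"
  proof -
    have "{x + y | x y. x \<in> W \<and> y \<in> W} = (\<Union>x\<in>W. \<Union>y\<in>W. {x + y})" by blast
    then show ?thesis using open_sums[of W W] W(1) by (simp only: disj_absorb)
  qed
  ultimately have "{x + y | x y. x \<in> W \<and> y \<in> W} \<subseteq> interior {x + y | x y. x \<in> S \<and> y \<in> S}"
    by (rule interior_maximal)
  then show ?thesis using W(2) by blast
qed

section \<open>Sums of continua\<close>

text \<open>The neighbourhood is the image of the connected product
  \<open>K \<times> ball 0 e\<close> under addition.\<close>

lemma connected_UN_ball:
  fixes K :: "'a::real_normed_vector set"
  assumes "connected K"
  shows "connected (\<Union>x\<in>K. ball x e)"
proof -
  have "(\<Union>x\<in>K. ball x e) = (\<lambda>(x, y). x + y) ` (K \<times> ball 0 e)"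
  proof (intro equalityI subsetI)
    fix z assume "z \<in> (\<Union>x\<in>K. ball x e)"
    then obtain x where "x \<in> K" "norm (z - x) < e"
      by (auto simp: dist_norm norm_minus_commute)
    then show "z \<in> (\<lambda>(x, y). x + y) ` (K \<times> ball 0 e)"
      by (intro image_eqI[of _ _ "(x, z - x)"]) auto
  qed (force simp: dist_norm)
  moreover have "connected ((\<lambda>(x, y). x + y) ` (K \<times> ball 0 e))"
    using assms by (intro connected_continuous_image connected_Times)
      (auto simp: case_prod_unfold intro!: continuous_intros)
  ultimately show ?thesis by simp
qed

text \<open>A path from \<open>a\<close> to \<open>b\<close> near \<open>K\<close>, repeated periodically along the direction \<open>b - a\<close>.\<close>
lemma periodic_path_near_connected:
  fixes K :: "'a::euclidean_space set"
  assumes "connected K" "a \<in> K" "b \<in> K" "0 < e"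
  shows "\<exists>\<gamma> :: real \<Rightarrow> 'a. continuous_on UNIV \<gamma> \<and>
    (\<forall>t. \<exists>x\<in>K. dist (\<gamma> t) (x + of_int \<lfloor>t\<rfloor> *\<^sub>R (b - a)) < e)"
proof -
  define U where "U = (\<Union>x\<in>K. ball x e)"
  have "open U" "connected U"
    unfolding U_def using connected_UN_ball[OF assms(1)] by auto
  then have "path_connected U"
    by (rule connected_open_path_connected)
  moreover have "a \<in> U" "b \<in> U"
    using assms(2-4) centre_in_ball unfolding U_def by blast+
  ultimately obtain g where "path g" "path_image g \<subseteq> U" "pathstart g = a" "pathfinish g = b"
    unfolding path_connected_def by blast
  then have g: "path g" "path_image g \<subseteq> U" "g 0 = a" "g 1 = b"
    by (simp_all add: pathstart_def pathfinish_def)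
  define \<gamma> where "\<gamma> t = g (frac t) + of_int \<lfloor>t\<rfloor> *\<^sub>R (b - a)" for t
  have piece: "continuous_on {of_int k..of_int k + 1} \<gamma>" for k
  proof (rule continuous_on_eq)
    show "continuous_on {of_int k..of_int k + 1} (\<lambda>t. g (t - of_int k) + of_int k *\<^sub>R (b - a))"
    proof -
      have "continuous_on {of_int k..of_int k + 1} (\<lambda>t. g (t - of_int k))"
        by (rule continuous_on_compose2[of "{0..1}" g])
          (use g(1) in \<open>auto simp: path_def intro!: continuous_intros\<close>)
      then show ?thesis
        by (rule continuous_on_add) (rule continuous_on_const)
    qed
    fix t :: real assume t: "t \<in> {of_int k..of_int k + 1}"
    show "g (t - of_int k) + of_int k *\<^sub>R (b - a) = \<gamma> t"
    \<comment> \<open>At the right end the floor jumps to \<open>k + 1\<close>; the two formulas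
      agree there because \<open>g 1 = b\<close> equals \<open>g 0 + (b - a)\<close>.\<close>
    proof (cases "t = of_int k + 1")
      case True
      then have "\<lfloor>t\<rfloor> = k + 1" "frac t = 0"
        by (auto simp: frac_def)
      then show ?thesis
        using True g by (simp add: \<gamma>_def algebra_simps)
    next
      case False
      then have "\<lfloor>t\<rfloor> = k" using t by (intro floor_unique) auto
      then show ?thesis by (simp add: \<gamma>_def frac_def)
    qed
  qed
  have "isCont \<gamma> t" for t
  proof -
    define k where "k = \<lfloor>t\<rfloor>"
    \<comment> \<open>Two adjacent intervals are joined so that \<open>t\<close> is an inner point
      even when it is an integer.\<close>
    have "continuous_on ({of_int (k - 1)..of_int (k - 1) + 1} \<union> {of_int k..of_int k + 1}) \<gamma>"
      by (intro continuous_on_closed_Un piece closed_atLeastAtMost)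
    then have "continuous_on {of_int k - 1<..<of_int k + 1} \<gamma>"
      by (rule continuous_on_subset) auto
    moreover have "t \<in> {of_int k - 1<..<of_int k + 1}"
      unfolding k_def using floor_correct[of t] by (simp; linarith)
    ultimately show ?thesis
      by (simp add: continuous_on_eq_continuous_at)
  qed
  then have "continuous_on UNIV \<gamma>"
    by (simp add: continuous_at_imp_continuous_on)
  moreover have "\<exists>x\<in>K. dist (\<gamma> t) (x + of_int \<lfloor>t\<rfloor> *\<^sub>R (b - a)) < e" for t
  proof -
    have "g (frac t) \<in> U"
      using g(2) frac_ge_0[of t] frac_lt_1[of t] unfolding path_image_def
      by (auto intro: less_imp_le)
    then obtain x where "x \<in> K" "dist x (g (frac t)) < e"
      unfolding U_def by auto
    then show ?thesis
      by (intro bexI[of _ x]) (simp_all add: \<gamma>_def dist_commute)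
  qed
  ultimately show ?thesis by blast
qed

text \<open>If the compact sum had no interior points, a finite union \<open>T\<close> of its
  translates would be meager. But \<open>T\<close> contains the unit ball, by Brouwer's theorem
  applied to a sum of periodic paths.\<close>

theorem interior_sums_of_continua:
  fixes K :: "nat \<Rightarrow> 'a::euclidean_space set"
  assumes K: "\<And>i. i < DIM('a) \<Longrightarrow> compact (K i) \<and> connected (K i) \<and> a i \<in> K i \<and> b i \<in> K i"
    and inj: "inj_on (\<lambda>i. b i - a i) {..<DIM('a)}"
    and ind: "independent ((\<lambda>i. b i - a i) ` {..<DIM('a)})"
  shows "interior (sums_of DIM('a) K) \<noteq> {}"
proof
  assume empty: "interior (sums_of DIM('a) K) = {}"
  define n where "n = DIM('a)"
  define v where "v i = b i - a i" for i
  define B where "B = v ` {..<n}"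
  have injv: "inj_on v {..<n}" and indB: "independent B"
    using inj ind unfolding n_def B_def v_def[abs_def] by auto
  have "card B = n"
    using injv unfolding B_def by (simp add: card_image)
  then have spanB: "span B = UNIV"
    using indB unfolding n_def by (metis dim_eq_full dim_eq_card_independent)
  define c where "c i x = representation B x (v i)" for i x
  have linc: "linear (c i)" for i
    unfolding c_def using indB spanB
    by (intro linearI) (simp_all add: representation_add representation_scale)
  have sumc: "(\<Sum>i<n. c i x *\<^sub>R v i) = x" for x
  proof -
    have "(\<Sum>w\<in>B. representation B x w *\<^sub>R w) = x"
      by (rule sum_representation_eq) (use indB spanB in \<open>auto simp: B_def\<close>)
    then show ?thesis
      unfolding B_def c_def using injv by (simp add: sum.reindex)
  qed
  have "\<forall>i. \<exists>C. \<forall>x. norm (c i x) \<le> C * norm x"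
    using linc linear_bounded by blast
  then obtain C where C: "\<And>i x. norm (c i x) \<le> C i * norm x"
    by metis
  have "\<forall>i. \<exists>R. i < n \<longrightarrow> (\<forall>x\<in>K i. norm x \<le> R)"
    using K unfolding n_def by (meson bounded_iff compact_imp_bounded)
  then obtain R where R: "\<And>i x. i < n \<Longrightarrow> x \<in> K i \<Longrightarrow> norm x \<le> R i"
    by metis
  have K': "compact (K i)" "connected (K i)" "a i \<in> K i" "b i \<in> K i" if "i < n" for i
    using K that by (auto simp: n_def)
  \<comment> \<open>This bounds the distance between \<open>F\<close> below and the identity: the
    \<open>i\<close>-th path differs from \<open>t *\<^sub>R v i\<close> by at most the path error
    1, the size of \<open>K i\<close> and one period.\<close>
  define r where "r = (\<Sum>i<n. 1 + R i + norm (v i))"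
  have "0 \<le> R i" if "i < n" for i
    using R[OF that K'(3)[OF that]] norm_ge_zero order_trans by blast
  moreover have "0 < n" by (simp add: n_def)
  ultimately have "0 < r"
    unfolding r_def by (intro sum_pos) (auto intro!: add_pos_nonneg)
  \<comment> \<open>All solutions \<open>x\<close> met below satisfy
    \<open>norm x \<le> 1 + r\<close>, so \<open>N\<close> bounds the floors of their coordinates.
    It does not depend on the precision \<open>e\<close>, which keeps the finite set of translations
    fixed.\<close>
  define N where "N = \<lceil>\<Sum>i<n. \<bar>C i\<bar> * (1 + r)\<rceil> + 1"
  define S where "S = sums_of n K"
  define \<Lambda> where "\<Lambda> = (\<lambda>k. \<Sum>i<n. of_int (k i) *\<^sub>R v i) ` (PiE {..<n} (\<lambda>_. {-N..N}))"
  define T where "T = (\<Union>l\<in>\<Lambda>. (+) l ` S)"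
  have "finite \<Lambda>"
    unfolding \<Lambda>_def by (intro finite_imageI finite_PiE) auto
  have "compact S"
    unfolding S_def using K' by (intro compact_sums_of)
  then have "closed T"
    unfolding T_def using \<open>finite \<Lambda>\<close> by (intro closed_UN) (auto intro: closed_translation compact_imp_closed)
  have "ball 0 1 \<subseteq> T"
  proof
    fix y :: 'a assume y: "y \<in> ball 0 1"
    \<comment> \<open>The paths run only near the continua, so points of \<open>T\<close> are
      obtained only near \<open>y\<close>; closedness of \<open>T\<close> then gives
      \<open>y\<close> itself.\<close>
    have "\<exists>z\<in>T. dist z y < e" if "0 < e" for e
    proof -
      \<comment> \<open>The final error is a sum of \<open>n\<close> path errors; the bound 1 keeps
        \<open>r\<close> valid for every \<open>e\<close>.\<close>
      define e' where "e' = min 1 (e / real n)"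
      have e': "0 < e'" "e' \<le> 1" "real n * e' \<le> e"
        using \<open>0 < e\<close> \<open>0 < n\<close> by (auto simp: e'_def min_def field_simps)
      have "\<exists>\<gamma> :: real \<Rightarrow> 'a. continuous_on UNIV \<gamma> \<and>
          (\<forall>t. \<exists>x\<in>K i. dist (\<gamma> t) (x + of_int \<lfloor>t\<rfloor> *\<^sub>R v i) < e')" if "i \<in> {..<n}" for i
        unfolding v_def by (rule periodic_path_near_connected) (use K' e'(1) that in auto)
      then have "\<exists>\<gamma> :: nat \<Rightarrow> real \<Rightarrow> 'a. \<forall>i\<in>{..<n}. continuous_on UNIV (\<gamma> i) \<and>
          (\<forall>t. \<exists>x\<in>K i. dist (\<gamma> i t) (x + of_int \<lfloor>t\<rfloor> *\<^sub>R v i) < e')"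
        by (intro bchoice ballI)
      then obtain \<gamma> :: "nat \<Rightarrow> real \<Rightarrow> 'a" where "\<forall>i\<in>{..<n}. continuous_on UNIV (\<gamma> i) \<and>
          (\<forall>t. \<exists>x\<in>K i. dist (\<gamma> i t) (x + of_int \<lfloor>t\<rfloor> *\<^sub>R v i) < e')"
        by blast
      then have \<gamma>: "\<And>i. i < n \<Longrightarrow> continuous_on UNIV (\<gamma> i)"
        "\<And>i t. i < n \<Longrightarrow> \<exists>x\<in>K i. dist (\<gamma> i t) (x + of_int \<lfloor>t\<rfloor> *\<^sub>R v i) < e'"
        by auto
      have near: "norm (t *\<^sub>R v i - \<gamma> i t) \<le> 1 + R i + norm (v i)" if i: "i < n" for i t
      proof -
        obtain x where x: "x \<in> K i" "dist (\<gamma> i t) (x + of_int \<lfloor>t\<rfloor> *\<^sub>R v i) < e'"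
          using \<gamma>(2)[OF i] by blast
        have "t *\<^sub>R v i - \<gamma> i t
            = frac t *\<^sub>R v i - x + ((x + of_int \<lfloor>t\<rfloor> *\<^sub>R v i) - \<gamma> i t)"
          by (simp add: frac_def algebra_simps)
        also have "norm \<dots> \<le> norm (frac t *\<^sub>R v i) + norm x + norm ((x + of_int \<lfloor>t\<rfloor> *\<^sub>R v i) - \<gamma> i t)"
          using norm_triangle_ineq norm_triangle_ineq4 by (smt (verit))
        also have "\<dots> \<le> norm (v i) + R i + 1"
        proof (intro add_mono)
          show "norm (frac t *\<^sub>R v i) \<le> norm (v i)"
            using frac_ge_0[of t] frac_lt_1[of t] by (simp add: mult_left_le_one_le)
          show "norm ((x + of_int \<lfloor>t\<rfloor> *\<^sub>R v i) - \<gamma> i t) \<le> 1"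
            using x(2) e'(2) by (simp add: dist_norm norm_minus_commute)
        qed (use R x i in auto)
        finally show ?thesis by simp
      qed
      define F where "F x = (\<Sum>i<n. \<gamma> i (c i x))" for x
      \<comment> \<open>The map \<open>x \<mapsto> y + (x - F x)\<close> sends the ball into itself,
        and its fixed points are the solutions.\<close>
      have "\<exists>x\<in>cball y r. F x = y"
      proof (rule brouwer_surjective_cball[where S = "{y}"])
        show "continuous_on (cball y r) F"
          unfolding F_def
        proof (intro continuous_on_sum)
          fix i assume "i \<in> {..<n}"
          then have "continuous_on UNIV (\<gamma> i)"
            using \<gamma>(1) by simp
          moreover have "continuous_on (cball y r) (c i)"
            using linc[of i] by (intro linear_continuous_on) (simp add: linear_conv_bounded_linear)
          ultimately show "continuous_on (cball y r) (\<lambda>x. \<gamma> i (c i x))"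
            by (rule continuous_on_compose2) simp
        qed
        fix w x assume "w \<in> {y}" "x \<in> cball y r"
        have "x - F x = (\<Sum>i<n. c i x *\<^sub>R v i - \<gamma> i (c i x))"
          unfolding sum_subtractf sumc F_def ..
        also have "norm \<dots> \<le> r"
          unfolding r_def using near by (intro sum_norm_le) auto
        finally show "w + (x - F x) \<in> cball y r"
          using \<open>w \<in> {y}\<close> by (simp add: dist_norm norm_minus_commute)
      qed (use \<open>0 < r\<close> in auto)
      then obtain x where x: "x \<in> cball y r" "F x = y" by blast
      have normx: "norm x \<le> 1 + r"
        using x(1) y norm_triangle_ineq[of y "x - y"] by (simp add: dist_norm norm_minus_commute)
      have "\<forall>i. \<exists>k. i < n \<longrightarrow> k \<in> K i \<and> dist (\<gamma> i (c i x)) (k + of_int \<lfloor>c i x\<rfloor> *\<^sub>R v i) < e'"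
        using \<gamma>(2) by blast
      then obtain k where k: "\<And>i. i < n \<Longrightarrow> k i \<in> K i"
        "\<And>i. i < n \<Longrightarrow> dist (\<gamma> i (c i x)) (k i + of_int \<lfloor>c i x\<rfloor> *\<^sub>R v i) < e'"
        by metis
      define l where "l = (\<Sum>i<n. of_int \<lfloor>c i x\<rfloor> *\<^sub>R v i)"
      define z where "z = l + (\<Sum>i<n. k i)"
      have "l \<in> \<Lambda>"
      proof -
        have "\<lfloor>c i x\<rfloor> \<in> {-N..N}" if "i < n" for i
        proof -
          have "\<bar>c i x\<bar> \<le> \<bar>C i\<bar> * (1 + r)"
          proof -
            have "\<bar>c i x\<bar> \<le> C i * norm x" using C[of i x] by simp
            also have "\<dots> \<le> \<bar>C i\<bar> * (1 + r)"
              using normx by (intro mult_mono) auto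
            finally show ?thesis .
          qed
          also have "\<dots> \<le> (\<Sum>i<n. \<bar>C i\<bar> * (1 + r))"
            using that \<open>0 < r\<close> by (intro member_le_sum) auto
          also have "\<dots> \<le> of_int (N - 1)"
            unfolding N_def by simp
          finally show ?thesis by (simp add: abs_le_iff; linarith)
        qed
        \<comment> \<open>Restriction to the index set makes the family of floors extensional, as
          \<open>PiE\<close> demands.\<close>
        then show ?thesis
          unfolding \<Lambda>_def l_def
          by (intro image_eqI[of _ _ "restrict (\<lambda>i. \<lfloor>c i x\<rfloor>) {..<n}"]) (auto intro!: sum.cong)
      qed
      moreover have "(\<Sum>i<n. k i) \<in> S"
        unfolding S_def sums_of_def using k(1) by blast
      ultimately have "z \<in> T"
        unfolding T_def z_def by blast
      moreover have "dist z y < e"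
      proof -
        have "y - z = (\<Sum>i<n. \<gamma> i (c i x) - (k i + of_int \<lfloor>c i x\<rfloor> *\<^sub>R v i))"
          unfolding x(2)[symmetric] F_def z_def l_def by (simp add: sum_subtractf sum.distrib)
        then have "norm (y - z) \<le> (\<Sum>i<n. norm (\<gamma> i (c i x) - (k i + of_int \<lfloor>c i x\<rfloor> *\<^sub>R v i)))"
          by (simp add: norm_sum)
        also have "\<dots> < (\<Sum>i<n. e')"
          using k(2) \<open>0 < n\<close> by (intro sum_strict_mono) (auto simp: dist_norm)
        also have "\<dots> \<le> e"
          using e'(3) by simp
        finally show ?thesis by (simp add: dist_norm norm_minus_commute)
      qed
      ultimately show ?thesis by blast
    qed
    then show "y \<in> T"
      using \<open>closed T\<close> closure_approachable[of y T] by simp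
  qed
  moreover have "meager_in euclidean T"
    unfolding T_def
  proof (intro meager_in_UN nowhere_dense_in_imp_meager_in)
    fix l assume "l \<in> \<Lambda>"
    have "closure ((+) l ` S) = (+) l ` S"
      using \<open>compact S\<close> by (simp add: closed_translation compact_imp_closed)
    moreover have "interior ((+) l ` S) = {}"
      using empty by (simp add: interior_translation S_def n_def)
    ultimately show "nowhere_dense_in euclidean ((+) l ` S)"
      by (simp add: nowhere_dense_in_euclidean_iff)
  qed (use \<open>finite \<Lambda>\<close> in \<open>simp add: countable_finite\<close>)
  ultimately show False
    using meager_in_euclidean_open_empty[of "ball 0 1 :: 'a set"] meager_in_subset by fastforce
qed

section \<open>Non-flatness and independent differences\<close>

text \<open>The vectors are chosen greedily: fewer than \<open>DIM('a)\<close> differences span a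
  proper subspace, and no translate of it can contain a set whose affine hull is the whole
  space.\<close>

lemma independent_differences:
  fixes W :: "nat \<Rightarrow> 'a::euclidean_space set"
  assumes "\<And>i. i < m \<Longrightarrow> affine hull (W i) = UNIV" "m \<le> DIM('a)"
  shows "\<exists>a b. (\<forall>i<m. a i \<in> W i \<and> b i \<in> W i) \<and> inj_on (\<lambda>i. b i - a i) {..<m}
    \<and> independent ((\<lambda>i. b i - a i) ` {..<m})"
  using assms
proof (induction m)
  case 0
  then show ?case by (simp add: independent_empty)
next
  case (Suc m)
  then obtain a b where ab: "\<forall>i<m. a i \<in> W i \<and> b i \<in> W i"
    and inj: "inj_on (\<lambda>i. b i - a i) {..<m}" and ind: "independent ((\<lambda>i. b i - a i) ` {..<m})"
    by force
  define B where "B = (\<lambda>i. b i - a i) ` {..<m}"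
  have "dim (span B) \<le> m"
    using dim_le_card'[of B] card_image_le[of "{..<m}" "\<lambda>i. b i - a i"] unfolding B_def by simp
  then have spanB: "span B \<noteq> UNIV"
    using Suc.prems(2) by (metis dim_UNIV not_less_eq_eq)
  have hull: "affine hull (W m) = UNIV" using Suc.prems(1) by simp
  then obtain p where p: "p \<in> W m"
    by (metis affine_hull_empty ex_in_conv empty_not_UNIV)
  have "\<not> W m \<subseteq> (+) p ` span B"
  proof
    assume "W m \<subseteq> (+) p ` span B"
    moreover have "affine ((+) p ` span B)"
      by (metis affine_translation subspace_imp_affine subspace_span)
    ultimately have "(+) p ` span B = UNIV"
      using hull hull_minimal[of "W m" "(+) p ` span B" affine] by auto
    then have "x \<in> span B" for x
      using image_iff[of "p + x" "(+) p" "span B"] by auto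
    then show False using spanB by blast
  qed
  then obtain q where q: "q \<in> W m" "q \<notin> (+) p ` span B" by blast
  have qp: "q - p \<notin> span B"
    using q(2) by (metis add.commute diff_add_cancel image_eqI)
  define a' b' where "a' = a(m := p)" and "b' = b(m := q)"
  have old: "b' i - a' i = b i - a i" if "i < m" for i
    using that by (simp add: a'_def b'_def)
  have new: "b' m - a' m = q - p" by (simp add: a'_def b'_def)
  have img: "(\<lambda>i. b' i - a' i) ` {..<m} = B"
    unfolding B_def using old by (intro image_cong) auto
  have "inj_on (\<lambda>i. b' i - a' i) {..<m}"
    using inj old by (simp add: inj_on_def)
  moreover have "q - p \<notin> B" using qp span_base by blast
  ultimately have "inj_on (\<lambda>i. b' i - a' i) {..<Suc m}"
    by (simp add: lessThan_Suc new img)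
  moreover have "independent ((\<lambda>i. b' i - a' i) ` {..<Suc m})"
    using ind qp unfolding lessThan_Suc image_insert img new
    by (intro independent_insertI) (auto simp: B_def)
  moreover have "\<forall>i<Suc m. a' i \<in> W i \<and> b' i \<in> W i"
    using ab p q by (auto simp: a'_def b'_def less_Suc_eq)
  ultimately show ?case by blast
qed

text \<open>Affine subspaces of a Euclidean space are closed, so non-flatness gives the affine hull
  interior points, and it must then be everything.\<close>

lemma affine_hull_eq_UNIV_if_not_flat:
  fixes A :: "'a::euclidean_space set"
  assumes "\<not> flat A"
  shows "affine hull A = UNIV"
  using assms affine_hull_nonempty_interior[of "affine hull A"]
  by (simp add: flat_def nowhere_dense_in_euclidean_iff)

lemma interior_nfold_sum_continuum:
  fixes K :: "'a::euclidean_space set"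
  assumes "continuum K" "\<not> flat K"
  shows "interior (nfold_sum DIM('a) K) \<noteq> {}"
proof -
  obtain a b where "\<forall>i<DIM('a). a i \<in> K \<and> b i \<in> K" "inj_on (\<lambda>i. b i - a i) {..<DIM('a)}"
      "independent ((\<lambda>i. b i - a i) ` {..<DIM('a)})"
    using independent_differences[of "DIM('a)" "\<lambda>_. K"] affine_hull_eq_UNIV_if_not_flat[OF assms(2)]
    by auto
  then show ?thesis
    unfolding nfold_sum_eq_sums_of
    using assms(1) interior_sums_of_continua[of "\<lambda>_. K" a b] by (simp add: continuum_def)
qed

section \<open>Sums of non-meager sets\<close>

text \<open>A Kuratowski-Ulam argument: for fixed \<open>y\<close> in the \<open>m\<close>-fold sum, the closed sets cover
  the non-meager set \<open>y + A\<close>, so one of them contains \<open>y + V\<close> for some basic open \<open>V\<close>; the sets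
  of those \<open>y\<close> form a countable closed cover of the \<open>m\<close>-fold sum.\<close>
lemma sums_of_open_subset_closed_cover:
  fixes K :: "'a::{real_normed_vector,second_countable_topology} set"
  assumes A: "\<not> meager_in (top_of_set K) A" "A \<subseteq> K"
    and "countable \<F>" "\<And>C. C \<in> \<F> \<Longrightarrow> closed C" "nfold_sum m A \<subseteq> \<Union>\<F>"
  shows "\<exists>C\<in>\<F>. \<exists>V. (\<forall>i<m. openin (top_of_set K) (V i) \<and> V i \<noteq> {}) \<and> sums_of m V \<subseteq> C"
  using assms(3-)
proof (induction m arbitrary: \<F>)
  case 0
  then show ?case by (auto simp: nfold_sum_eq_sums_of)
next
  case (Suc m)
  obtain \<B> :: "'a set set" where "countable \<B>" "{} \<notin> \<B>"
    and \<B>: "\<And>V. V \<in> \<B> \<Longrightarrow> openin (top_of_set K) V"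
      "\<And>T. openin (top_of_set K) T \<Longrightarrow> \<exists>\<U>. \<U> \<subseteq> \<B> \<and> T = \<Union>\<U>"
    by (rule subset_second_countable[of K]) blast
  \<comment> \<open>This is the set of all \<open>y\<close> for which \<open>y + V\<close> lies in
    \<open>C\<close>, written as an intersection of preimages to make its closedness
    visible.\<close>
  define G where "G V C = (\<Inter>v\<in>V. (\<lambda>y. y + v) -` C)" for V C :: "'a set"
  have "closed D" if "D \<in> (\<lambda>(V, C). G V C) ` (\<B> \<times> \<F>)" for D
    using that Suc.prems(2) unfolding G_def
    by (auto intro!: closed_INT closed_vimage continuous_intros)
  moreover have "countable ((\<lambda>(V, C). G V C) ` (\<B> \<times> \<F>))"
    using \<open>countable \<B>\<close> Suc.prems(1) by simp
  moreover have "nfold_sum m A \<subseteq> \<Union>((\<lambda>(V, C). G V C) ` (\<B> \<times> \<F>))"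
  proof
    fix y assume y: "y \<in> nfold_sum m A"
    have "y + x \<in> \<Union>\<F>" if "x \<in> A" for x
      using that y Suc.prems(3) unfolding nfold_sum_eq_sums_of sums_of_Suc by blast
    then have "A \<subseteq> \<Union>((\<lambda>C. K \<inter> (\<lambda>x. y + x) -` C) ` \<F>)"
      using A(2) by auto
    moreover have "closedin (top_of_set K) (K \<inter> (\<lambda>x. y + x) -` C)" if "C \<in> \<F>" for C
      using Suc.prems(2)[OF that]
      by (intro continuous_closedin_preimage continuous_intros)
    ultimately obtain C where C: "C \<in> \<F>"
        "(top_of_set K) interior_of (K \<inter> (\<lambda>x. y + x) -` C) \<noteq> {}"
      using non_meager_in_imp_interior_of[OF A(1), of "(\<lambda>C. K \<inter> (\<lambda>x. y + x) -` C) ` \<F>"] Suc.prems(1)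
      by auto
    obtain \<U> where "\<U> \<subseteq> \<B>" "(top_of_set K) interior_of (K \<inter> (\<lambda>x. y + x) -` C) = \<Union>\<U>"
      using \<B>(2) openin_interior_of by metis
    then obtain V where "V \<in> \<B>" "V \<subseteq> K \<inter> (\<lambda>x. y + x) -` C"
      using C(2) interior_of_subset[of "top_of_set K" "K \<inter> (\<lambda>x. y + x) -` C"] by blast
    then have "y \<in> G V C" by (auto simp: G_def)
    then show "y \<in> \<Union>((\<lambda>(V, C). G V C) ` (\<B> \<times> \<F>))"
      using \<open>V \<in> \<B>\<close> C(1) by blast
  qed
  ultimately obtain D V where "D \<in> (\<lambda>(V, C). G V C) ` (\<B> \<times> \<F>)"
    and V: "\<forall>i<m. openin (top_of_set K) (V i) \<and> V i \<noteq> {}" "sums_of m V \<subseteq> D"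
    using Suc.IH by meson
  then obtain U C where UC: "U \<in> \<B>" "C \<in> \<F>" "D = G U C" by auto
  define V' where "V' = V(m := U)"
  have "sums_of m V' \<subseteq> sums_of m V"
    by (rule sums_of_mono) (simp add: V'_def)
  then have "sums_of (Suc m) V' \<subseteq> C"
    using V(2) unfolding sums_of_Suc UC(3) G_def by (auto simp: V'_def)
  moreover have "\<forall>i<Suc m. openin (top_of_set K) (V' i) \<and> V' i \<noteq> {}"
    using V(1) UC(1) \<B>(1) \<open>{} \<notin> \<B>\<close> by (auto simp: V'_def less_Suc_eq)
  ultimately show ?case using UC(2) by blast
qed

text \<open>Choose \<open>W\<close> in a ball whose closed version meets \<open>K\<close> only
  inside \<open>V\<close>; as \<open>K\<close> is compact, the closure of \<open>W\<close> stays in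
  that intersection. This closure is the small continuum used for sums, while \<open>W\<close>
  itself, being relatively open, inherits non-flatness.\<close>

lemma locally_connected_shrink:
  fixes K :: "'a::euclidean_space set"
  assumes "compact K" "locally connected K" "openin (top_of_set K) V" "V \<noteq> {}"
  shows "\<exists>W. openin (top_of_set K) W \<and> W \<noteq> {} \<and> connected W \<and> compact (closure W) \<and> closure W \<subseteq> V"
proof -
  obtain x where x: "x \<in> V" using assms(4) by blast
  then obtain e where e: "0 < e" "cball x e \<inter> K \<subseteq> V"
    using assms(3) unfolding openin_contains_cball by blast
  have "x \<in> K" using x assms(3) openin_imp_subset by blast
  then have "openin (top_of_set K) (K \<inter> ball x e)" "x \<in> K \<inter> ball x e"
    using e by auto
  then obtain W where W: "openin (top_of_set K) W" "connected W" "x \<in> W" "W \<subseteq> K \<inter> ball x e"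
    using assms(2) unfolding locally_connected by meson
  have KB: "compact (K \<inter> cball x e)" using assms(1) by (intro compact_Int) auto
  have "W \<subseteq> K \<inter> cball x e" using W(4) by auto
  then have "closure W \<subseteq> K \<inter> cball x e" "bounded W"
    using closure_minimal[OF _ compact_imp_closed[OF KB]] bounded_subset[OF compact_imp_bounded[OF KB]]
    by blast+
  then have "closure W \<subseteq> V" "compact (closure W)"
    using e(2) by (auto simp: compact_closure)
  then show ?thesis using W by blast
qed

lemma not_meager_nfold_sum:
  fixes K :: "'a::euclidean_space set"
  assumes K: "compact K" "locally connected K" "nowhere_flat K"
    and A: "A \<subseteq> K" "\<not> meager_in (top_of_set K) A"
  shows "\<not> meager_in euclidean (nfold_sum DIM('a) A)"
proof
  assume "meager_in euclidean (nfold_sum DIM('a) A)"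
  from meager_in_closed_cover[OF this] obtain \<F> where \<F>: "countable \<F>"
      "\<forall>C\<in>\<F>. closedin euclidean C \<and> euclidean interior_of C = {}"
      "nfold_sum DIM('a) A \<subseteq> \<Union>\<F>"
    by (elim exE conjE) rule
  have "\<exists>C\<in>\<F>. \<exists>V. (\<forall>i<DIM('a). openin (top_of_set K) (V i) \<and> V i \<noteq> {}) \<and> sums_of DIM('a) V \<subseteq> C"
    using \<F> by (intro sums_of_open_subset_closed_cover[OF A(2,1)]) auto
  then obtain C V where "C \<in> \<F>" and V: "sums_of DIM('a) V \<subseteq> C"
      "\<forall>i<DIM('a). openin (top_of_set K) (V i) \<and> V i \<noteq> {}"
    by blast
  have "\<exists>W. openin (top_of_set K) W \<and> W \<noteq> {} \<and> connected W \<and>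
      compact (closure W) \<and> closure W \<subseteq> V i" if "i \<in> {..<DIM('a)}" for i
    using V(2) that by (intro locally_connected_shrink[OF K(1,2)]) auto
  then have "\<exists>W. \<forall>i\<in>{..<DIM('a)}. openin (top_of_set K) (W i) \<and> W i \<noteq> {} \<and> connected (W i) \<and>
      compact (closure (W i)) \<and> closure (W i) \<subseteq> V i"
    by (intro bchoice ballI)
  then obtain W where "\<forall>i\<in>{..<DIM('a)}. openin (top_of_set K) (W i) \<and> W i \<noteq> {} \<and> connected (W i) \<and>
      compact (closure (W i)) \<and> closure (W i) \<subseteq> V i"
    by blast
  then have W: "openin (top_of_set K) (W i)" "W i \<noteq> {}" "connected (W i)"
      "compact (closure (W i))" "closure (W i) \<subseteq> V i" if "i < DIM('a)" for i
    using that by auto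
  \<comment> \<open>Nowhere flatness enters here: each small open set spans affinely, so one basis
    vector can be taken as a difference of points from each of them.\<close>
  have "affine hull (W i) = UNIV" if "i < DIM('a)" for i
    using W(1,2)[OF that] K(3) unfolding nowhere_flat_def
    by (intro affine_hull_eq_UNIV_if_not_flat) blast
  then obtain a b where ab: "\<forall>i<DIM('a). a i \<in> W i \<and> b i \<in> W i"
      "inj_on (\<lambda>i. b i - a i) {..<DIM('a)}" "independent ((\<lambda>i. b i - a i) ` {..<DIM('a)})"
    using independent_differences[of "DIM('a)" W] by auto
  have "interior (sums_of DIM('a) (\<lambda>i. closure (W i))) \<noteq> {}"
  proof (rule interior_sums_of_continua[OF _ ab(2,3)])
    fix i assume "i < DIM('a)"
    then show "compact (closure (W i)) \<and> connected (closure (W i)) \<and> a i \<in> closure (W i) \<and> b i \<in> closure (W i)"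
      using W(3,4)[of i] ab(1) closure_subset[of "W i"] by (auto intro: connected_imp_connected_closure)
  qed
  moreover have "sums_of DIM('a) (\<lambda>i. closure (W i)) \<subseteq> C"
    using sums_of_mono[of "DIM('a)" "\<lambda>i. closure (W i)" V] W(5) V(1) by (meson subset_trans)
  moreover have "interior C = {}"
    using \<F>(2) \<open>C \<in> \<F>\<close> by simp
  ultimately show False
    using interior_mono[of "sums_of DIM('a) (\<lambda>i. closure (W i))" C] by simp
qed

lemma interior_nfold_sum_analytic:
  fixes K :: "'a::euclidean_space set"
  assumes K: "compact K" "locally connected K" "nowhere_flat K"
    and A: "A \<subseteq> K" "analytic A" "\<not> meager_in (top_of_set K) A"
  shows "interior (nfold_sum (2 * DIM('a)) A) \<noteq> {}"
proof -
  have "analytic (nfold_sum DIM('a) A)"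
    using A(2) by (simp add: analytic_nfold_sum)
  then obtain X :: "(nat \<Rightarrow> real) topology" and f where
    X: "polish X" "continuous_map X euclidean f" "f ` topspace X = nfold_sum DIM('a) A"
    unfolding analytic_def by blast
  obtain W where "open W" "W \<noteq> {}" "meager_in euclidean (W - nfold_sum DIM('a) A)"
    using polish_image_comeager_in_open[OF X(1,2)] not_meager_nfold_sum[OF K A(1,3)]
    unfolding X(3) by blast
  \<comment> \<open>The second factor of two comes from adding the comeager part of the
    \<open>n\<close>-fold sum to itself.\<close>
  then show ?thesis
    using interior_sums_comeager[of W "nfold_sum DIM('a) A"] by (simp add: mult_2 nfold_sum_add)
qed

theorem theorem3:
  shows "(\<forall>K :: (real ^ 'n) set.
            continuum K \<and> \<not> flat K \<longrightarrow>
              interior (nfold_sum CARD('n) K) \<noteq> {} \<and> K \<in> class_A \<and> K \<in> class_B)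
       \<and> (\<forall>K :: (real ^ 'n) set.
            continuum K \<and> locally connected K \<and> nowhere_flat K \<longrightarrow>
              (\<forall>A. A \<subseteq> K \<and> analytic A \<and> \<not> meager_in (top_of_set K) A \<longrightarrow>
                interior (nfold_sum (2 * CARD('n)) A) \<noteq> {} \<and> A \<in> class_A \<and> A \<in> class_B))"
proof -
  have dim: "DIM(real ^ 'n) = CARD('n)" by simp
  have classes: "T \<in> class_A \<and> T \<in> class_B"
    if "interior (nfold_sum m T) \<noteq> {}" "0 < m" for T :: "(real ^ 'n) set" and m
    using class_A_if_interior_nfold_sum[OF that] class_A_subset_class_B by blast
  have "interior (nfold_sum CARD('n) K) \<noteq> {} \<and> K \<in> class_A \<and> K \<in> class_B"
    if "continuum K" "\<not> flat K" for K :: "(real ^ 'n) set"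
    using interior_nfold_sum_continuum[OF that] classes[of "CARD('n)" K] unfolding dim by simp
  moreover have "interior (nfold_sum (2 * CARD('n)) A) \<noteq> {} \<and> A \<in> class_A \<and> A \<in> class_B"
    if "continuum K" "locally connected K" "nowhere_flat K"
      "A \<subseteq> K" "analytic A" "\<not> meager_in (top_of_set K) A" for K A :: "(real ^ 'n) set"
    using interior_nfold_sum_analytic[of K A] classes[of "2 * CARD('n)" A] that
    unfolding dim continuum_def by simp
  ultimately show ?thesis by blast
qed

end
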